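(* Let $\mathbf{Coarse}_{\mathrm{CtrMap}}/\mathrm{close}$ be the category whose objects are coarse spaces and whose morphisms $X\to Y$ are closeness classes $[f]_{\mathrm{CtrMap}}$ of controlled maps $f:X\to Y$, and let $\mathbf{Coarse}_{\mathrm{CtrTotRel}}/\mathrm{close}$ be the category whose objects are coarse spaces and whose morphisms $X\to Y$ are closeness classes $[\eta]_{\mathrm{CtrTotRel}}$ of controlled total relations $\eta$ from $X$ to $Y$. These two categories are isomorphic via the functor defined by $$X\mapsto X,\qquad [f]_{\mathrm{CtrMap}}\mapsto [f]_{\mathrm{CtrTotRel}},$$ where a map $f:X\to Y$ is regarded as the relation $\{(f(x),x)\mid x\in X\}\subset Y\times X$.
   Context: Throughout, "set" means an element of a fixed universe $\mathcal U$ with $\mathbb N\in\mathcal U$. Relations. For sets $X,Y$, a relation from $X$ to $Y$ is a subset $R\subset Y\times X$; $\mathrm{Rel}(X,Y)=\mathcal P(Y\times X)$ and $\mathrm{Rel}(X)=\mathrm{Rel}(X,X)$. For $R\in\mathrm{Rel}(X,Y)$, $S\in\mathrm{Rel}(Y,Z)$, $S\circ R=\{(z,x)\mid \exists y\in Y,\ (z,y)\in S,\ (y,x)\in R\}$; $1_X^{\mathrm{Rel}}=\{(x,x)\mid x\in X\}$; $R^\dagger=\{(x,y)\mid (y,x)\in R\}\in\mathrm{Rel}(Y,X)$; for $E\in\mathrm{Rel}(X)$, $\mathrm{Ad}_R(E)=R\circ E\circ R^\dagger\in\mathrm{Rel}(Y)$. $R\in\mathrm{Rel}(X,Y)$ is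 total if for every $x\in X$ there is $y\in Y$ with $(y,x)\in R$. Coarse spaces. A coarse structure on a set $X$ is a subset $\mathcal E\subset\mathrm{Rel}(X)$ containing $1_X^{\mathrm{Rel}}$ and closed under composition, dagger, finite unions and passing to subsets. A coarse space is a pair $X=(X,\mathcal E_X)$ of a set and a coarse structure on it. Controlled. For coarse spaces $X,Y$, a relation $\eta\in\mathrm{Rel}(X,Y)$ is controlled if $\mathrm{Ad}_\eta(E)\in\mathcal E_Y$ for all $E\in\mathcal E_X$; a map $f:X\to Y$ is controlled if $\mathrm{Ad}_f(E)=\{(f(x_1),f(x_2))\mid(x_1,x_2)\in E\}\in\mathcal E_Y$ for all $E\in\mathcal E_X$. $\mathrm{CtrTotRel}(X,Y)$ is the set of controlled total relations. Closeness. Controlled maps $f_1,f_2:X\to Y$ are close if $\{(f_1(x),f_2(x))\mid x\in X\}\in\mathcal E_Y$. For $\eta_1,\eta_2\in\mathrm{Rel}(X,Y)$, $\eta_1\prec\eta_2$ means there exist $E\in\mathcal E_X$, $F\in\mathcal E_Y$ with $\eta_1\subset F\circ\eta_2\circ E$; $\eta_1,\eta_2$ are close, $\eta_1\sim\eta_2$, if $\eta_1\prec\eta_2$ and $\eta_2\prec\eta_1$. Closeness is a congruence both on the category of coarse spaces and controlled maps and on the category of coarse spaces and controlled total relations; the two categories in the claim are the corresponding quotient categories. *)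

theory Defs
  imports Main "HOL-Library.FuncSet"
begin

section \<open>Categories\<close>

text \<open>
  Hom-sets are indexed by source and target, so they need not be disjoint; composition of
  g : Y to Z with f : X to Y is \<open>Cmp C X Y Z g f\<close>.
\<close>

record ('o, 'm) cat =
  Obj :: "'o set"
  Hom :: "'o \<Rightarrow> 'o \<Rightarrow> 'm set"
  Cmp :: "'o \<Rightarrow> 'o \<Rightarrow> 'o \<Rightarrow> 'm \<Rightarrow> 'm \<Rightarrow> 'm"
  Ide :: "'o \<Rightarrow> 'm"

definition is_category :: "('o, 'm) cat \<Rightarrow> bool" where
  "is_category C \<longleftrightarrow>
     (\<forall>X\<in>Obj C. Ide C X \<in> Hom C X X) \<and>
     (\<forall>X\<in>Obj C. \<forall>Y\<in>Obj C. \<forall>Z\<in>Obj C. \<forall>g\<in>Hom C Y Z. \<forall>f\<in>Hom C X Y.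
        Cmp C X Y Z g f \<in> Hom C X Z) \<and>
     (\<forall>X\<in>Obj C. \<forall>Y\<in>Obj C. \<forall>f\<in>Hom C X Y.
        Cmp C X Y Y (Ide C Y) f = f \<and> Cmp C X X Y f (Ide C X) = f) \<and>
     (\<forall>W\<in>Obj C. \<forall>X\<in>Obj C. \<forall>Y\<in>Obj C. \<forall>Z\<in>Obj C.
        \<forall>h\<in>Hom C Y Z. \<forall>g\<in>Hom C X Y. \<forall>f\<in>Hom C W X.
        Cmp C W Y Z h (Cmp C W X Y g f) = Cmp C W X Z (Cmp C X Y Z h g) f)"

record ('o, 'm, 'p, 'n) ftor =
  fobj :: "'o \<Rightarrow> 'p"
  fhom :: "'o \<Rightarrow> 'o \<Rightarrow> 'm \<Rightarrow> 'n"

definition is_functor ::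
    "('o, 'm) cat \<Rightarrow> ('p, 'n) cat \<Rightarrow> ('o, 'm, 'p, 'n) ftor \<Rightarrow> bool" where
  "is_functor C D F \<longleftrightarrow>
     is_category C \<and> is_category D \<and>
     (\<forall>X\<in>Obj C. fobj F X \<in> Obj D) \<and>
     (\<forall>X\<in>Obj C. \<forall>Y\<in>Obj C. \<forall>f\<in>Hom C X Y.
        fhom F X Y f \<in> Hom D (fobj F X) (fobj F Y)) \<and>
     (\<forall>X\<in>Obj C. fhom F X X (Ide C X) = Ide D (fobj F X)) \<and>
     (\<forall>X\<in>Obj C. \<forall>Y\<in>Obj C. \<forall>Z\<in>Obj C. \<forall>g\<in>Hom C Y Z. \<forall>f\<in>Hom C X Y.
        fhom F X Z (Cmp C X Y Z g f) =
        Cmp D (fobj F X) (fobj F Y) (fobj F Z) (fhom F Y Z g) (fhom F X Y f))"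

definition left_inverse_functor ::
    "('o, 'm) cat \<Rightarrow> ('p, 'n, 'o, 'm) ftor \<Rightarrow> ('o, 'm, 'p, 'n) ftor \<Rightarrow> bool" where
  "left_inverse_functor C G F \<longleftrightarrow>
     (\<forall>X\<in>Obj C. fobj G (fobj F X) = X) \<and>
     (\<forall>X\<in>Obj C. \<forall>Y\<in>Obj C. \<forall>f\<in>Hom C X Y.
        fhom G (fobj F X) (fobj F Y) (fhom F X Y f) = f)"

definition is_category_isomorphism ::
    "('o, 'm) cat \<Rightarrow> ('p, 'n) cat \<Rightarrow> ('o, 'm, 'p, 'n) ftor \<Rightarrow> bool" where
  "is_category_isomorphism C D F \<longleftrightarrow>
     is_functor C D F \<and>
     (\<exists>G. is_functor D C G \<and> left_inverse_functor C G F \<and> left_inverse_functor D F G)"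

text \<open>
  For a congruence \<open>R\<close> the union in the composition ranges over equal classes, so it is the
  class of the composite of any two representatives.
\<close>

definition quotient_category ::
    "('o, 'm) cat \<Rightarrow> ('o \<Rightarrow> 'o \<Rightarrow> 'm rel) \<Rightarrow> ('o, 'm set) cat" where
  "quotient_category C R =
     \<lparr> Obj = Obj C,
       Hom = (\<lambda>X Y. Hom C X Y // R X Y),
       Cmp = (\<lambda>X Y Z c d. \<Union>g\<in>c. \<Union>f\<in>d. R X Z `` {Cmp C X Y Z g f}),
       Ide = (\<lambda>X. R X X `` {Ide C X}) \<rparr>"

section \<open>Coarse spaces\<close>

text \<open>
  A relation from \<open>X\<close> to \<open>Y\<close> is a subset of \<open>Y \<times> X\<close>, so the composite of \<open>R\<close> followed
  by \<open>S\<close> is \<open>S O R\<close>.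
\<close>

record 'a coarse_space =
  points :: "'a set"
  entourages :: "'a rel set"

definition coarse_structure :: "'a set \<Rightarrow> 'a rel set \<Rightarrow> bool" where
  "coarse_structure X \<E> \<longleftrightarrow>
     \<E> \<subseteq> Pow (X \<times> X) \<and>
     Id_on X \<in> \<E> \<and>
     (\<forall>E\<in>\<E>. \<forall>F\<in>\<E>. E O F \<in> \<E>) \<and>
     (\<forall>E\<in>\<E>. E\<inverse> \<in> \<E>) \<and>
     (\<forall>E\<in>\<E>. \<forall>F\<in>\<E>. E \<union> F \<in> \<E>) \<and>
     (\<forall>E\<in>\<E>. \<forall>F. F \<subseteq> E \<longrightarrow> F \<in> \<E>)"

definition Ad :: "('b \<times> 'a) set \<Rightarrow> 'a rel \<Rightarrow> 'b rel" where
  "Ad R E = R O E O R\<inverse>"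

definition controlled_relation ::
    "'a coarse_space \<Rightarrow> 'b coarse_space \<Rightarrow> ('b \<times> 'a) set \<Rightarrow> bool" where
  "controlled_relation X Y \<eta> \<longleftrightarrow>
     \<eta> \<subseteq> points Y \<times> points X \<and> (\<forall>E\<in>entourages X. Ad \<eta> E \<in> entourages Y)"

definition total_relation :: "'a set \<Rightarrow> 'b set \<Rightarrow> ('b \<times> 'a) set \<Rightarrow> bool" where
  "total_relation X Y R \<longleftrightarrow> R \<subseteq> Y \<times> X \<and> (\<forall>x\<in>X. \<exists>y\<in>Y. (y, x) \<in> R)"

definition CtrTotRel :: "'a coarse_space \<Rightarrow> 'b coarse_space \<Rightarrow> ('b \<times> 'a) set set" where
  "CtrTotRel X Y =
     {\<eta>. controlled_relation X Y \<eta> \<and> total_relation (points X) (points Y) \<eta>}"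

text \<open>
  Maps are extensional functions, so that equality of maps is equality of functions.
\<close>

definition CtrMap :: "'a coarse_space \<Rightarrow> 'b coarse_space \<Rightarrow> ('a \<Rightarrow> 'b) set" where
  "CtrMap X Y =
     {f \<in> points X \<rightarrow>\<^sub>E points Y.
        \<forall>E\<in>entourages X. {(f x\<^sub>1, f x\<^sub>2) | x\<^sub>1 x\<^sub>2. (x\<^sub>1, x\<^sub>2) \<in> E} \<in> entourages Y}"

definition graph :: "'a set \<Rightarrow> ('a \<Rightarrow> 'b) \<Rightarrow> ('b \<times> 'a) set" where
  "graph X f = {(f x, x) | x. x \<in> X}"

section \<open>Closeness\<close>

definition close_maps ::
    "'a coarse_space \<Rightarrow> 'b coarse_space \<Rightarrow> ('a \<Rightarrow> 'b) \<Rightarrow> ('a \<Rightarrow> 'b) \<Rightarrow> bool" where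
  "close_maps X Y f\<^sub>1 f\<^sub>2 \<longleftrightarrow> {(f\<^sub>1 x, f\<^sub>2 x) | x. x \<in> points X} \<in> entourages Y"

definition prec_relations ::
    "'a coarse_space \<Rightarrow> 'b coarse_space \<Rightarrow> ('b \<times> 'a) set \<Rightarrow> ('b \<times> 'a) set \<Rightarrow> bool" where
  "prec_relations X Y \<eta>\<^sub>1 \<eta>\<^sub>2 \<longleftrightarrow>
     (\<exists>E\<in>entourages X. \<exists>F\<in>entourages Y. \<eta>\<^sub>1 \<subseteq> F O \<eta>\<^sub>2 O E)"

definition close_relations ::
    "'a coarse_space \<Rightarrow> 'b coarse_space \<Rightarrow> ('b \<times> 'a) set \<Rightarrow> ('b \<times> 'a) set \<Rightarrow> bool" where
  "close_relations X Y \<eta>\<^sub>1 \<eta>\<^sub>2 \<longleftrightarrow> prec_relations X Y \<eta>\<^sub>1 \<eta>\<^sub>2 \<and> prec_relations X Y \<eta>\<^sub>2 \<eta>\<^sub>1"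

definition closeness_CtrMap ::
    "'a coarse_space \<Rightarrow> 'b coarse_space \<Rightarrow> ('a \<Rightarrow> 'b) rel" where
  "closeness_CtrMap X Y =
     {(f\<^sub>1, f\<^sub>2). f\<^sub>1 \<in> CtrMap X Y \<and> f\<^sub>2 \<in> CtrMap X Y \<and> close_maps X Y f\<^sub>1 f\<^sub>2}"

definition closeness_CtrTotRel ::
    "'a coarse_space \<Rightarrow> 'b coarse_space \<Rightarrow> ('b \<times> 'a) set rel" where
  "closeness_CtrTotRel X Y =
     {(\<eta>\<^sub>1, \<eta>\<^sub>2). \<eta>\<^sub>1 \<in> CtrTotRel X Y \<and> \<eta>\<^sub>2 \<in> CtrTotRel X Y \<and> close_relations X Y \<eta>\<^sub>1 \<eta>\<^sub>2}"

definition class_CtrMap ::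
    "'a coarse_space \<Rightarrow> 'b coarse_space \<Rightarrow> ('a \<Rightarrow> 'b) \<Rightarrow> ('a \<Rightarrow> 'b) set" where
  "class_CtrMap X Y f = closeness_CtrMap X Y `` {f}"

definition class_CtrTotRel ::
    "'a coarse_space \<Rightarrow> 'b coarse_space \<Rightarrow> ('b \<times> 'a) set \<Rightarrow> ('b \<times> 'a) set set" where
  "class_CtrTotRel X Y \<eta> = closeness_CtrTotRel X Y `` {\<eta>}"

section \<open>The two quotient categories\<close>

text \<open>
  The family \<open>\<U>\<close> is the universe of sets that may underlie a coarse space; entourages of
  such a space then are sets of pairs of its points and need no size condition of their own.
  No closure property of \<open>\<U>\<close> is imposed.
\<close>

definition coarse_spaces :: "'a set set \<Rightarrow> 'a coarse_space set" where
  "coarse_spaces \<U> = {X. points X \<in> \<U> \<and> coarse_structure (points X) (entourages X)}"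

definition Coarse_CtrMap :: "'a set set \<Rightarrow> ('a coarse_space, 'a \<Rightarrow> 'a) cat" where
  "Coarse_CtrMap \<U> =
     \<lparr> Obj = coarse_spaces \<U>,
       Hom = CtrMap,
       Cmp = (\<lambda>X Y Z g f. compose (points X) g f),
       Ide = (\<lambda>X. \<lambda>x\<in>points X. x) \<rparr>"

definition Coarse_CtrTotRel :: "'a set set \<Rightarrow> ('a coarse_space, 'a rel) cat" where
  "Coarse_CtrTotRel \<U> =
     \<lparr> Obj = coarse_spaces \<U>,
       Hom = CtrTotRel,
       Cmp = (\<lambda>X Y Z S R. S O R),
       Ide = (\<lambda>X. Id_on (points X)) \<rparr>"

definition Coarse_CtrMap_close :: "'a set set \<Rightarrow> ('a coarse_space, ('a \<Rightarrow> 'a) set) cat" where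
  "Coarse_CtrMap_close \<U> = quotient_category (Coarse_CtrMap \<U>) closeness_CtrMap"

definition Coarse_CtrTotRel_close :: "'a set set \<Rightarrow> ('a coarse_space, 'a rel set) cat" where
  "Coarse_CtrTotRel_close \<U> = quotient_category (Coarse_CtrTotRel \<U>) closeness_CtrTotRel"

end

theory Submission
  imports Defs
begin

text \<open>
  Sending a controlled map to its graph is a functor from controlled maps to controlled total
  relations that fixes every coarse space.  Like any functor that respects two congruences it
  descends to the quotient categories; there it is bijective on hom-sets as soon as it also
  reflects the congruences and meets every class of the target.  Bijectivity on objects and
  hom-sets is what makes a functor invertible (\<open>category_isomorphism_if_bijective\<close>).

  That closeness is reflected and that every class is met both come from totality.  If \<open>\<theta>\<close> is
  total, then a deviation \<open>E\<close> in its source can be pushed to its target,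
  \<open>\<theta> O E \<subseteq> Ad \<theta> E O \<theta>\<close>, and \<open>Ad \<theta> E\<close> is an entourage if \<open>\<theta>\<close> is controlled.  Hence
  \<open>\<eta> \<prec> \<theta>\<close> only means \<open>\<eta> \<subseteq> F O \<theta>\<close> for one entourage \<open>F\<close> of the target
  (\<open>prec_relations_iff\<close>).  For graphs this inclusion says that \<open>(f x, g x) \<in> F\<close> for all \<open>x\<close>,
  that is, closeness of maps (\<open>close_graphs_iff\<close>).  And if \<open>f\<close> chooses one value of a
  controlled total relation \<open>\<eta>\<close> at each point, then any two values of \<open>\<eta>\<close> at a point differ by
  the entourage \<open>Ad \<eta> Id\<close>, so that \<open>\<eta>\<close> is close to the graph of \<open>f\<close>
  (\<open>ex_close_graph\<close>).
\<close>

section \<open>Functors and quotient categories\<close>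

lemma is_categoryD:
  assumes "is_category C"
  shows "X \<in> Obj C \<Longrightarrow> Ide C X \<in> Hom C X X"
    and "X \<in> Obj C \<Longrightarrow> Y \<in> Obj C \<Longrightarrow> Z \<in> Obj C \<Longrightarrow> g \<in> Hom C Y Z \<Longrightarrow> f \<in> Hom C X Y \<Longrightarrow>
      Cmp C X Y Z g f \<in> Hom C X Z"
    and "X \<in> Obj C \<Longrightarrow> Y \<in> Obj C \<Longrightarrow> f \<in> Hom C X Y \<Longrightarrow> Cmp C X Y Y (Ide C Y) f = f"
    and "X \<in> Obj C \<Longrightarrow> Y \<in> Obj C \<Longrightarrow> f \<in> Hom C X Y \<Longrightarrow> Cmp C X X Y f (Ide C X) = f"
    and "W \<in> Obj C \<Longrightarrow> X \<in> Obj C \<Longrightarrow> Y \<in> Obj C \<Longrightarrow> Z \<in> Obj C \<Longrightarrow>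
      h \<in> Hom C Y Z \<Longrightarrow> g \<in> Hom C X Y \<Longrightarrow> f \<in> Hom C W X \<Longrightarrow>
      Cmp C W Y Z h (Cmp C W X Y g f) = Cmp C W X Z (Cmp C X Y Z h g) f"
  using assms unfolding is_category_def by blast+

lemma is_functorD:
  assumes "is_functor C D F"
  shows "is_category C" and "is_category D"
    and "X \<in> Obj C \<Longrightarrow> fobj F X \<in> Obj D"
    and "X \<in> Obj C \<Longrightarrow> Y \<in> Obj C \<Longrightarrow> f \<in> Hom C X Y \<Longrightarrow>
      fhom F X Y f \<in> Hom D (fobj F X) (fobj F Y)"
    and "X \<in> Obj C \<Longrightarrow> fhom F X X (Ide C X) = Ide D (fobj F X)"
    and "X \<in> Obj C \<Longrightarrow> Y \<in> Obj C \<Longrightarrow> Z \<in> Obj C \<Longrightarrow> g \<in> Hom C Y Z \<Longrightarrow> f \<in> Hom C X Y \<Longrightarrow>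
      fhom F X Z (Cmp C X Y Z g f) =
      Cmp D (fobj F X) (fobj F Y) (fobj F Z) (fhom F Y Z g) (fhom F X Y f)"
  using assms unfolding is_functor_def by blast+

text \<open>
  The inverse functor is the pointwise inverse of \<open>F\<close>; it preserves identities and composites
  because \<open>F\<close> does and is injective on hom-sets.
\<close>

lemma category_isomorphism_if_bijective:
  assumes F: "is_functor C D F"
    and obj: "bij_betw (fobj F) (Obj C) (Obj D)"
    and hom: "\<And>X Y. X \<in> Obj C \<Longrightarrow> Y \<in> Obj C \<Longrightarrow>
      bij_betw (fhom F X Y) (Hom C X Y) (Hom D (fobj F X) (fobj F Y))"
  shows "is_category_isomorphism C D F"
proof -
  define o' where "o' = inv_into (Obj C) (fobj F)"
  define h' where "h' = (\<lambda>U V. inv_into (Hom C (o' U) (o' V)) (fhom F (o' U) (o' V)))"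
  define G where "G = \<lparr>fobj = o', fhom = h'\<rparr>"
  have o_in: "o' U \<in> Obj C" and Fo: "fobj F (o' U) = U" if "U \<in> Obj D" for U
    using that obj unfolding o'_def bij_betw_def
    by (auto intro: inv_into_into f_inv_into_f)
  have oF: "o' (fobj F X) = X" if "X \<in> Obj C" for X
    using that obj unfolding o'_def by (auto simp: bij_betw_def)
  have bij: "bij_betw (fhom F (o' U) (o' V)) (Hom C (o' U) (o' V)) (Hom D U V)"
    if "U \<in> Obj D" "V \<in> Obj D" for U V
    using hom[OF o_in[OF that(1)] o_in[OF that(2)]] that by (simp add: Fo)
  have h_in: "h' U V u \<in> Hom C (o' U) (o' V)" and Fh: "fhom F (o' U) (o' V) (h' U V u) = u"
    if "U \<in> Obj D" "V \<in> Obj D" "u \<in> Hom D U V" for U V u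
    using bij[OF that(1,2)] that(3) unfolding h'_def bij_betw_def
    by (auto intro: inv_into_into f_inv_into_f)
  have hF: "h' U V (fhom F (o' U) (o' V) f) = f"
    if "U \<in> Obj D" "V \<in> Obj D" "f \<in> Hom C (o' U) (o' V)" for U V f
    using bij[OF that(1,2)] that(3) unfolding h'_def by (simp add: bij_betw_def)
  have "is_functor D C G"
    unfolding is_functor_def
  proof (intro conjI ballI)
    show "is_category D" "is_category C" using is_functorD(1,2)[OF F] by blast+
    note catC = is_categoryD[OF \<open>is_category C\<close>]
    fix U assume U: "U \<in> Obj D"
    show "fobj G U \<in> Obj C" using o_in[OF U] by (simp add: G_def)
    have "h' U U (fhom F (o' U) (o' U) (Ide C (o' U))) = Ide C (o' U)"
      using hF U o_in catC(1) by blast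
    then show "fhom G U U (Ide D U) = Ide C (fobj G U)"
      using is_functorD(5)[OF F o_in[OF U]] by (simp add: G_def Fo U)
    fix V assume V: "V \<in> Obj D"
    show "fhom G U V u \<in> Hom C (fobj G U) (fobj G V)" if "u \<in> Hom D U V" for u
      using h_in U V that by (simp add: G_def)
    fix W v u assume W: "W \<in> Obj D" and v: "v \<in> Hom D V W" and u: "u \<in> Hom D U V"
    let ?c = "Cmp C (o' U) (o' V) (o' W) (h' V W v) (h' U V u)"
    have "fhom F (o' U) (o' W) ?c = Cmp D U V W v u"
      using is_functorD(6)[OF F o_in o_in o_in h_in h_in] U V W v u by (simp add: Fo Fh)
    moreover have "?c \<in> Hom C (o' U) (o' W)"
      using catC(2) o_in h_in U V W v u by blast
    ultimately show "fhom G U W (Cmp D U V W v u) =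
        Cmp C (fobj G U) (fobj G V) (fobj G W) (fhom G V W v) (fhom G U V u)"
      using hF[OF U W] by (simp add: G_def) metis
  qed
  moreover have "left_inverse_functor C G F"
    unfolding left_inverse_functor_def
    using hF is_functorD(3)[OF F] by (simp add: G_def oF) (metis oF)
  moreover have "left_inverse_functor D F G"
    unfolding left_inverse_functor_def by (simp add: G_def Fo Fh)
  ultimately show ?thesis
    unfolding is_category_isomorphism_def using F by blast
qed

definition category_congruence ::
    "('o, 'm) cat \<Rightarrow> ('o \<Rightarrow> 'o \<Rightarrow> 'm rel) \<Rightarrow> bool" where
  "category_congruence C R \<longleftrightarrow>
     (\<forall>X\<in>Obj C. \<forall>Y\<in>Obj C. equiv (Hom C X Y) (R X Y)) \<and>
     (\<forall>X\<in>Obj C. \<forall>Y\<in>Obj C. \<forall>Z\<in>Obj C. \<forall>(g, g')\<in>R Y Z. \<forall>(f, f')\<in>R X Y.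
        (Cmp C X Y Z g f, Cmp C X Y Z g' f') \<in> R X Z)"

lemma category_congruenceD:
  assumes "category_congruence C R"
  shows "X \<in> Obj C \<Longrightarrow> Y \<in> Obj C \<Longrightarrow> equiv (Hom C X Y) (R X Y)"
    and "X \<in> Obj C \<Longrightarrow> Y \<in> Obj C \<Longrightarrow> Z \<in> Obj C \<Longrightarrow> (g, g') \<in> R Y Z \<Longrightarrow> (f, f') \<in> R X Y \<Longrightarrow>
      (Cmp C X Y Z g f, Cmp C X Y Z g' f') \<in> R X Z"
  using assms unfolding category_congruence_def by blast+

lemma Cmp_quotient_category:
  assumes R: "category_congruence C R"
    and X: "X \<in> Obj C" and Y: "Y \<in> Obj C" and Z: "Z \<in> Obj C"
    and g: "g \<in> Hom C Y Z" and f: "f \<in> Hom C X Y"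
  shows "Cmp (quotient_category C R) X Y Z (R Y Z `` {g}) (R X Y `` {f}) =
    R X Z `` {Cmp C X Y Z g f}"
proof -
  note eq = category_congruenceD(1)[OF R] and cmp = category_congruenceD(2)[OF R X Y Z]
  have *: "R X Z `` {Cmp C X Y Z g' f'} = R X Z `` {Cmp C X Y Z g f}"
    if "(g, g') \<in> R Y Z" "(f, f') \<in> R X Y" for g' f'
    using equiv_class_eq[OF eq[OF X Z] cmp[OF that]] by simp
  have "(\<Union>g'\<in>R Y Z `` {g}. \<Union>f'\<in>R X Y `` {f}. R X Z `` {Cmp C X Y Z g' f'}) =
      R X Z `` {Cmp C X Y Z g f}"
    using * equiv_class_self[OF eq[OF Y Z] g] equiv_class_self[OF eq[OF X Y] f]
    by blast
  then show ?thesis by (simp add: quotient_category_def)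
qed

lemma quotient_category_simps [simp]:
  "Obj (quotient_category C R) = Obj C"
  "Hom (quotient_category C R) X Y = Hom C X Y // R X Y"
  "Ide (quotient_category C R) X = R X X `` {Ide C X}"
  by (simp_all add: quotient_category_def)

lemma is_category_quotient_category:
  assumes C: "is_category C" and R: "category_congruence C R"
  shows "is_category (quotient_category C R)"
proof -
  note cmp = Cmp_quotient_category[OF R] and cat = is_categoryD[OF C]
  show ?thesis
    unfolding is_category_def quotient_category_simps
    by (intro conjI ballI; (elim quotientE)?) (auto simp: cmp cat intro!: quotientI)
qed

definition quotient_functor ::
    "('p \<Rightarrow> 'p \<Rightarrow> 'n rel) \<Rightarrow> ('o, 'm, 'p, 'n) ftor \<Rightarrow> ('o, 'm set, 'p, 'n set) ftor" where
  "quotient_functor S F =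
     \<lparr> fobj = fobj F,
       fhom = (\<lambda>X Y c. \<Union>f\<in>c. S (fobj F X) (fobj F Y) `` {fhom F X Y f}) \<rparr>"

lemma fobj_quotient_functor [simp]: "fobj (quotient_functor S F) = fobj F"
  by (simp add: quotient_functor_def)

lemma fhom_quotient_functor:
  assumes F: "is_functor C D F"
    and R: "category_congruence C R" and S: "category_congruence D S"
    and X: "X \<in> Obj C" and Y: "Y \<in> Obj C" and f: "f \<in> Hom C X Y"
    and resp: "\<And>f f'. (f, f') \<in> R X Y \<Longrightarrow>
      (fhom F X Y f, fhom F X Y f') \<in> S (fobj F X) (fobj F Y)"
  shows "fhom (quotient_functor S F) X Y (R X Y `` {f}) =
    S (fobj F X) (fobj F Y) `` {fhom F X Y f}"
proof -
  have eqS: "equiv (Hom D (fobj F X) (fobj F Y)) (S (fobj F X) (fobj F Y))"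
    using category_congruenceD(1)[OF S] is_functorD(3)[OF F] X Y by blast
  have "(\<lambda>f. S (fobj F X) (fobj F Y) `` {fhom F X Y f}) respects R X Y"
    by (intro congruentI equiv_class_eq[OF eqS resp])
  from UN_equiv_class[OF category_congruenceD(1)[OF R X Y] this f]
  show ?thesis by (simp add: quotient_functor_def)
qed

text \<open>
  Respecting the congruences makes the induced functor well defined, reflecting them makes it
  injective on hom-sets, and meeting every class makes it surjective there.
\<close>

lemma category_isomorphism_quotient_functor:
  assumes F: "is_functor C D F"
    and R: "category_congruence C R" and S: "category_congruence D S"
    and obj: "bij_betw (fobj F) (Obj C) (Obj D)"
    and iff: "\<And>X Y f g. X \<in> Obj C \<Longrightarrow> Y \<in> Obj C \<Longrightarrow> f \<in> Hom C X Y \<Longrightarrow> g \<in> Hom C X Y \<Longrightarrow>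
      (fhom F X Y f, fhom F X Y g) \<in> S (fobj F X) (fobj F Y) \<longleftrightarrow> (f, g) \<in> R X Y"
    and full: "\<And>X Y h. X \<in> Obj C \<Longrightarrow> Y \<in> Obj C \<Longrightarrow> h \<in> Hom D (fobj F X) (fobj F Y) \<Longrightarrow>
      \<exists>f\<in>Hom C X Y. (fhom F X Y f, h) \<in> S (fobj F X) (fobj F Y)"
  shows "is_category_isomorphism (quotient_category C R) (quotient_category D S)
    (quotient_functor S F)"
proof (rule category_isomorphism_if_bijective)
  note eqR = category_congruenceD(1)[OF R] and eqS = category_congruenceD(1)[OF S]
  note Fo = is_functorD(3)[OF F] and Fh = is_functorD(4)[OF F]
  have fh: "fhom (quotient_functor S F) X Y (R X Y `` {f}) =
      S (fobj F X) (fobj F Y) `` {fhom F X Y f}"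
    if "X \<in> Obj C" "Y \<in> Obj C" "f \<in> Hom C X Y" for X Y f
  proof (rule fhom_quotient_functor[OF F R S that])
    show "(fhom F X Y f, fhom F X Y f') \<in> S (fobj F X) (fobj F Y)" if "(f, f') \<in> R X Y" for f f'
      using that iff equiv_type[OF eqR] \<open>X \<in> Obj C\<close> \<open>Y \<in> Obj C\<close> by blast
  qed
  note catC = is_categoryD[OF is_functorD(1)[OF F]]
  show "is_functor (quotient_category C R) (quotient_category D S) (quotient_functor S F)"
    unfolding is_functor_def quotient_category_simps fobj_quotient_functor
  proof (intro conjI ballI; (elim quotientE)?)
    show "is_category (quotient_category C R)" "is_category (quotient_category D S)"
      using is_category_quotient_category is_functorD(1,2)[OF F] R S by blast+
  qed (auto simp: fh Fo Fh catC is_functorD(5,6)[OF F] Cmp_quotient_category[OF R]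
      Cmp_quotient_category[OF S] intro!: quotientI)
  show "bij_betw (fobj (quotient_functor S F)) (Obj (quotient_category C R))
      (Obj (quotient_category D S))"
    using obj by simp
  fix X Y assume "X \<in> Obj (quotient_category C R)" "Y \<in> Obj (quotient_category C R)"
  then have X: "X \<in> Obj C" and Y: "Y \<in> Obj C" by simp_all
  let ?S = "S (fobj F X) (fobj F Y)"
  have eqS': "equiv (Hom D (fobj F X) (fobj F Y)) ?S" using eqS Fo X Y by blast
  have "inj_on (fhom (quotient_functor S F) X Y) (Hom C X Y // R X Y)"
  proof (rule inj_onI; elim quotientE)
    fix c d f g
    assume eq: "fhom (quotient_functor S F) X Y c = fhom (quotient_functor S F) X Y d"
      and c: "c = R X Y `` {f}" and d: "d = R X Y `` {g}"
      and f: "f \<in> Hom C X Y" and g: "g \<in> Hom C X Y"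
    have "?S `` {fhom F X Y f} = ?S `` {fhom F X Y g}"
      using eq c d fh X Y f g by simp
    then have "(fhom F X Y f, fhom F X Y g) \<in> ?S"
      using eq_equiv_class_iff[OF eqS' Fh[OF X Y f] Fh[OF X Y g]] by simp
    then show "c = d"
      using iff X Y f g c d equiv_class_eq[OF eqR[OF X Y]] by blast
  qed
  moreover have "fhom (quotient_functor S F) X Y ` (Hom C X Y // R X Y) =
      Hom D (fobj F X) (fobj F Y) // ?S"
  proof (rule set_eqI, rule iffI)
    fix c assume "c \<in> fhom (quotient_functor S F) X Y ` (Hom C X Y // R X Y)"
    then show "c \<in> Hom D (fobj F X) (fobj F Y) // ?S"
      by (auto elim!: quotientE simp: fh X Y Fh intro!: quotientI)
  next
    fix c assume "c \<in> Hom D (fobj F X) (fobj F Y) // ?S"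
    then obtain h where h: "h \<in> Hom D (fobj F X) (fobj F Y)" "c = ?S `` {h}"
      by (rule quotientE)
    then obtain f where f: "f \<in> Hom C X Y" "(fhom F X Y f, h) \<in> ?S"
      using full X Y by blast
    then have "c = fhom (quotient_functor S F) X Y (R X Y `` {f})"
      using fh X Y h equiv_class_eq[OF eqS'] by auto
    then show "c \<in> fhom (quotient_functor S F) X Y ` (Hom C X Y // R X Y)"
      using quotientI[OF f(1)] by blast
  qed
  ultimately show "bij_betw (fhom (quotient_functor S F) X Y)
      (Hom (quotient_category C R) X Y)
      (Hom (quotient_category D S) (fobj (quotient_functor S F) X) (fobj (quotient_functor S F) Y))"
    by (simp add: bij_betw_def)
qed

section \<open>Controlled total relations up to closeness\<close>

lemma coarse_structureD:
  assumes "coarse_structure X \<E>"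
  shows "E \<in> \<E> \<Longrightarrow> E \<subseteq> X \<times> X" and "Id_on X \<in> \<E>"
    and "E \<in> \<E> \<Longrightarrow> F \<in> \<E> \<Longrightarrow> E O F \<in> \<E>"
    and "E \<in> \<E> \<Longrightarrow> E\<inverse> \<in> \<E>"
    and "E \<in> \<E> \<Longrightarrow> F \<subseteq> E \<Longrightarrow> F \<in> \<E>"
  using assms unfolding coarse_structure_def by (meson PowD subsetD)+

lemma CtrTotRelD:
  assumes "\<eta> \<in> CtrTotRel X Y"
  shows "\<eta> \<subseteq> points Y \<times> points X"
    and "E \<in> entourages X \<Longrightarrow> Ad \<eta> E \<in> entourages Y"
    and "x \<in> points X \<Longrightarrow> \<exists>y. (y, x) \<in> \<eta>"
  using assms unfolding CtrTotRel_def controlled_relation_def total_relation_def by blast+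

lemma Ad_relcomp: "Ad (\<theta> O \<eta>) E = Ad \<theta> (Ad \<eta> E)"
  unfolding Ad_def by (simp add: converse_relcomp O_assoc)

lemma Id_on_mem_CtrTotRel:
  assumes "coarse_structure (points X) (entourages X)"
  shows "Id_on (points X) \<in> CtrTotRel X X"
proof -
  have "Ad (Id_on (points X)) E \<in> entourages X" if "E \<in> entourages X" for E
    by (rule coarse_structureD(5)[OF assms that]) (auto simp: Ad_def)
  then show ?thesis
    unfolding CtrTotRel_def controlled_relation_def total_relation_def by auto
qed

lemma relcomp_mem_CtrTotRel:
  assumes \<theta>: "\<theta> \<in> CtrTotRel Y Z" and \<eta>: "\<eta> \<in> CtrTotRel X Y"
  shows "\<theta> O \<eta> \<in> CtrTotRel X Z"
proof -
  have "\<exists>z\<in>points Z. (z, x) \<in> \<theta> O \<eta>" if x: "x \<in> points X" for x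
  proof -
    obtain y where y: "(y, x) \<in> \<eta>" using CtrTotRelD(3)[OF \<eta> x] by blast
    then have "y \<in> points Y" using CtrTotRelD(1)[OF \<eta>] by blast
    then obtain z where "(z, y) \<in> \<theta>" using CtrTotRelD(3)[OF \<theta>] by blast
    with y show ?thesis using CtrTotRelD(1)[OF \<theta>] by blast
  qed
  moreover have "Ad (\<theta> O \<eta>) E \<in> entourages Z" if "E \<in> entourages X" for E
    using CtrTotRelD(2)[OF \<eta>] CtrTotRelD(2)[OF \<theta>] that by (simp add: Ad_relcomp)
  moreover have "\<theta> O \<eta> \<subseteq> points Z \<times> points X"
    using CtrTotRelD(1)[OF \<eta>] CtrTotRelD(1)[OF \<theta>] by blast
  ultimately show ?thesis
    unfolding CtrTotRel_def controlled_relation_def total_relation_def by blast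
qed

text \<open>
  Totality gives every source point of \<open>E\<close> a value under \<open>\<theta>\<close>, so the detour along \<open>\<theta>\<inverse>\<close> and
  back along \<open>\<theta>\<close> loses nothing.
\<close>

lemma total_relcomp_subset_Ad:
  assumes "total_relation X Y \<theta>" and "E \<subseteq> A \<times> X"
  shows "\<theta> O E \<subseteq> Ad \<theta> E O \<theta>"
  using assms unfolding total_relation_def Ad_def by fast

text \<open>
  A source entourage \<open>E\<close> is absorbed into the target entourage \<open>F O Ad \<theta> E\<close>.
\<close>

lemma prec_relations_iff:
  assumes X: "coarse_structure (points X) (entourages X)"
    and Y: "coarse_structure (points Y) (entourages Y)"
    and \<theta>: "\<theta> \<in> CtrTotRel X Y"
  shows "prec_relations X Y \<eta> \<theta> \<longleftrightarrow> (\<exists>F\<in>entourages Y. \<eta> \<subseteq> F O \<theta>)"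
proof
  assume "prec_relations X Y \<eta> \<theta>"
  then obtain E F where E: "E \<in> entourages X" and F: "F \<in> entourages Y"
    and sub: "\<eta> \<subseteq> F O \<theta> O E"
    unfolding prec_relations_def by blast
  have "\<theta> O E \<subseteq> Ad \<theta> E O \<theta>"
    using total_relcomp_subset_Ad coarse_structureD(1)[OF X E] \<theta>
    unfolding CtrTotRel_def by blast
  with sub have "\<eta> \<subseteq> (F O Ad \<theta> E) O \<theta>" by blast
  moreover have "F O Ad \<theta> E \<in> entourages Y"
    using coarse_structureD(3)[OF Y F] CtrTotRelD(2)[OF \<theta> E] by blast
  ultimately show "\<exists>F\<in>entourages Y. \<eta> \<subseteq> F O \<theta>" by blast
next
  assume "\<exists>F\<in>entourages Y. \<eta> \<subseteq> F O \<theta>"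
  then obtain F where F: "F \<in> entourages Y" "\<eta> \<subseteq> F O \<theta>" by blast
  have "\<theta> = \<theta> O Id_on (points X)" using CtrTotRelD(1)[OF \<theta>] by auto
  then have "\<eta> \<subseteq> F O \<theta> O Id_on (points X)" using F(2) by simp
  then show "prec_relations X Y \<eta> \<theta>"
    unfolding prec_relations_def using F(1) coarse_structureD(2)[OF X] by blast
qed

lemma prec_relations_if_subset:
  assumes X: "coarse_structure (points X) (entourages X)"
    and Y: "coarse_structure (points Y) (entourages Y)"
    and \<theta>: "\<theta> \<in> CtrTotRel X Y" and "\<eta> \<subseteq> \<theta>"
  shows "prec_relations X Y \<eta> \<theta>"
proof -
  have "\<eta> \<subseteq> Id_on (points Y) O \<theta>" using CtrTotRelD(1)[OF \<theta>] assms(4) by blast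
  then show ?thesis
    using prec_relations_iff[OF X Y \<theta>] coarse_structureD(2)[OF Y] by blast
qed

lemma prec_relations_trans:
  assumes X: "coarse_structure (points X) (entourages X)"
    and Y: "coarse_structure (points Y) (entourages Y)"
    and "prec_relations X Y \<eta> \<theta>" and "prec_relations X Y \<theta> \<zeta>"
  shows "prec_relations X Y \<eta> \<zeta>"
proof -
  obtain E F where E: "E \<in> entourages X" "F \<in> entourages Y" "\<eta> \<subseteq> F O \<theta> O E"
    using assms(3) unfolding prec_relations_def by blast
  obtain E' F' where E': "E' \<in> entourages X" "F' \<in> entourages Y" "\<theta> \<subseteq> F' O \<zeta> O E'"
    using assms(4) unfolding prec_relations_def by blast
  have "\<eta> \<subseteq> (F O F') O \<zeta> O (E' O E)"
    using E(3) E'(3) by blast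
  then show ?thesis
    unfolding prec_relations_def
    using coarse_structureD(3)[OF X E'(1) E(1)] coarse_structureD(3)[OF Y E(2) E'(2)] by blast
qed

text \<open>
  The entourage \<open>F\<close> that separates the inner relations ends up between \<open>\<theta>'\<close> and \<open>\<eta>'\<close>;
  totality of \<open>\<theta>'\<close> moves it out to the target.
\<close>

lemma prec_relations_relcomp:
  assumes X: "coarse_structure (points X) (entourages X)"
    and Y: "coarse_structure (points Y) (entourages Y)"
    and Z: "coarse_structure (points Z) (entourages Z)"
    and \<eta>': "\<eta>' \<in> CtrTotRel X Y" and \<theta>': "\<theta>' \<in> CtrTotRel Y Z"
    and "prec_relations X Y \<eta> \<eta>'" and "prec_relations Y Z \<theta> \<theta>'"
  shows "prec_relations X Z (\<theta> O \<eta>) (\<theta>' O \<eta>')"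
proof -
  obtain F where F: "F \<in> entourages Y" "\<eta> \<subseteq> F O \<eta>'"
    using assms(6) prec_relations_iff[OF X Y \<eta>'] by blast
  obtain G where G: "G \<in> entourages Z" "\<theta> \<subseteq> G O \<theta>'"
    using assms(7) prec_relations_iff[OF Y Z \<theta>'] by blast
  have "\<theta>' O F \<subseteq> Ad \<theta>' F O \<theta>'"
    using total_relcomp_subset_Ad coarse_structureD(1)[OF Y F(1)] \<theta>'
    unfolding CtrTotRel_def by blast
  with F(2) G(2) have "\<theta> O \<eta> \<subseteq> (G O Ad \<theta>' F) O (\<theta>' O \<eta>')" by blast
  moreover have "G O Ad \<theta>' F \<in> entourages Z"
    using coarse_structureD(3)[OF Z G(1)] CtrTotRelD(2)[OF \<theta>' F(1)] by blast
  ultimately show ?thesis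
    using prec_relations_iff[OF X Z relcomp_mem_CtrTotRel[OF \<theta>' \<eta>']] by blast
qed

lemma equiv_closeness_CtrTotRel:
  assumes X: "coarse_structure (points X) (entourages X)"
    and Y: "coarse_structure (points Y) (entourages Y)"
  shows "equiv (CtrTotRel X Y) (closeness_CtrTotRel X Y)"
proof (rule equivI)
  show "closeness_CtrTotRel X Y \<subseteq> CtrTotRel X Y \<times> CtrTotRel X Y"
    unfolding closeness_CtrTotRel_def by blast
  show "refl_on (CtrTotRel X Y) (closeness_CtrTotRel X Y)"
    using prec_relations_if_subset[OF X Y]
    unfolding closeness_CtrTotRel_def close_relations_def refl_on_def by blast
  show "sym (closeness_CtrTotRel X Y)"
    unfolding closeness_CtrTotRel_def close_relations_def sym_def by blast
  show "trans (closeness_CtrTotRel X Y)"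
    unfolding closeness_CtrTotRel_def close_relations_def
    by (rule transI) (use prec_relations_trans[OF X Y] in blast)
qed

lemma relcomp_closeness_CtrTotRel:
  assumes X: "coarse_structure (points X) (entourages X)"
    and Y: "coarse_structure (points Y) (entourages Y)"
    and Z: "coarse_structure (points Z) (entourages Z)"
    and \<theta>: "(\<theta>, \<theta>') \<in> closeness_CtrTotRel Y Z" and \<eta>: "(\<eta>, \<eta>') \<in> closeness_CtrTotRel X Y"
  shows "(\<theta> O \<eta>, \<theta>' O \<eta>') \<in> closeness_CtrTotRel X Z"
  using \<theta> \<eta> prec_relations_relcomp[OF X Y Z]
  unfolding closeness_CtrTotRel_def close_relations_def
  by (auto intro: relcomp_mem_CtrTotRel)

section \<open>Controlled maps up to closeness\<close>

lemma CtrMapD: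
  assumes "f \<in> CtrMap X Y"
  shows "f \<in> points X \<rightarrow>\<^sub>E points Y"
    and "E \<in> entourages X \<Longrightarrow> {(f x, f x') | x x'. (x, x') \<in> E} \<in> entourages Y"
  using assms unfolding CtrMap_def by blast+

lemma CtrMap_mem: "f \<in> CtrMap X Y \<Longrightarrow> x \<in> points X \<Longrightarrow> f x \<in> points Y"
  using CtrMapD(1) by (auto dest: PiE_mem)

lemma CtrMap_funcset: "f \<in> CtrMap X Y \<Longrightarrow> f \<in> points X \<rightarrow> points Y"
  by (rule funcsetI) (rule CtrMap_mem)

lemma id_mem_CtrMap:
  assumes X: "coarse_structure (points X) (entourages X)"
  shows "(\<lambda>x\<in>points X. x) \<in> CtrMap X X"
proof -
  have "{((\<lambda>x\<in>points X. x) x, (\<lambda>x\<in>points X. x) x') | x x'. (x, x') \<in> E} \<in> entourages X"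
    if E: "E \<in> entourages X" for E
    by (rule coarse_structureD(5)[OF X E]) (use coarse_structureD(1)[OF X E] in auto)
  then show ?thesis unfolding CtrMap_def by auto
qed

lemma compose_mem_CtrMap:
  assumes X: "coarse_structure (points X) (entourages X)"
    and g: "g \<in> CtrMap Y Z" and f: "f \<in> CtrMap X Y"
  shows "compose (points X) g f \<in> CtrMap X Z"
proof -
  have "{(compose (points X) g f x, compose (points X) g f x') | x x'. (x, x') \<in> E}
      \<in> entourages Z" if E: "E \<in> entourages X" for E
  proof -
    have "compose (points X) g f x = g (f x)" "compose (points X) g f x' = g (f x')"
      if "(x, x') \<in> E" for x x'
      using that coarse_structureD(1)[OF X E] by (auto simp: compose_def)
    then have "{(compose (points X) g f x, compose (points X) g f x') | x x'. (x, x') \<in> E} =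
        {(g (f x), g (f x')) | x x'. (x, x') \<in> E}"
      by (metis (no_types, lifting))
    also have "\<dots> = {(g y, g y') | y y'. (y, y') \<in> {(f x, f x') | x x'. (x, x') \<in> E}}"
      by blast
    finally have "{(compose (points X) g f x, compose (points X) g f x') | x x'. (x, x') \<in> E} =
        \<dots>" .
    then show ?thesis using CtrMapD(2)[OF g CtrMapD(2)[OF f E]] by simp
  qed
  moreover have "compose (points X) g f \<in> points X \<rightarrow>\<^sub>E points Z"
    using CtrMap_mem[OF g] CtrMap_mem[OF f] by (auto simp: compose_def)
  ultimately show ?thesis unfolding CtrMap_def by blast
qed

lemma Ad_graph:
  assumes "E \<subseteq> X \<times> X"
  shows "Ad (graph X f) E = {(f x, f x') | x x'. (x, x') \<in> E}"
  using assms unfolding Ad_def graph_def by blast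

lemma graph_mem_CtrTotRel_iff:
  assumes X: "coarse_structure (points X) (entourages X)"
    and f: "f \<in> points X \<rightarrow>\<^sub>E points Y"
  shows "graph (points X) f \<in> CtrTotRel X Y \<longleftrightarrow> f \<in> CtrMap X Y"
proof -
  have "graph (points X) f \<subseteq> points Y \<times> points X"
    using f unfolding graph_def by (auto dest: PiE_mem)
  moreover have "\<forall>x\<in>points X. \<exists>y\<in>points Y. (y, x) \<in> graph (points X) f"
    using f unfolding graph_def by (auto dest: PiE_mem)
  moreover have "Ad (graph (points X) f) E = {(f x, f x') | x x'. (x, x') \<in> E}"
    if "E \<in> entourages X" for E
    using Ad_graph coarse_structureD(1)[OF X that] by blast
  ultimately show ?thesis
    using f unfolding CtrTotRel_def CtrMap_def controlled_relation_def total_relation_def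
    by simp
qed

lemma graph_mem_CtrTotRel:
  assumes "coarse_structure (points X) (entourages X)" and "f \<in> CtrMap X Y"
  shows "graph (points X) f \<in> CtrTotRel X Y"
  using graph_mem_CtrTotRel_iff[OF assms(1) CtrMapD(1)[OF assms(2)]] assms(2) by blast

lemma prec_graphs_iff:
  assumes X: "coarse_structure (points X) (entourages X)"
    and Y: "coarse_structure (points Y) (entourages Y)"
    and g: "g \<in> CtrMap X Y"
  shows "prec_relations X Y (graph (points X) f) (graph (points X) g) \<longleftrightarrow> close_maps X Y f g"
proof -
  have "graph (points X) f \<subseteq> F O graph (points X) g \<longleftrightarrow>
      {(f x, g x) | x. x \<in> points X} \<subseteq> F" for F
    unfolding graph_def by blast
  moreover have "(\<exists>F\<in>entourages Y. A \<subseteq> F) \<longleftrightarrow> A \<in> entourages Y" for A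
    by (meson coarse_structureD(5)[OF Y] order_refl)
  ultimately show ?thesis
    unfolding close_maps_def prec_relations_iff[OF X Y graph_mem_CtrTotRel[OF X g]] by simp
qed

lemma close_maps_sym:
  assumes Y: "coarse_structure (points Y) (entourages Y)" and "close_maps X Y f g"
  shows "close_maps X Y g f"
proof -
  have "{(g x, f x) | x. x \<in> points X} = {(f x, g x) | x. x \<in> points X}\<inverse>" by blast
  then show ?thesis
    using coarse_structureD(4)[OF Y] assms(2) unfolding close_maps_def by simp
qed

lemma close_graphs_iff:
  assumes X: "coarse_structure (points X) (entourages X)"
    and Y: "coarse_structure (points Y) (entourages Y)"
    and f: "f \<in> CtrMap X Y" and g: "g \<in> CtrMap X Y"
  shows "(graph (points X) f, graph (points X) g) \<in> closeness_CtrTotRel X Y \<longleftrightarrow>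
    (f, g) \<in> closeness_CtrMap X Y"
  using prec_graphs_iff[OF X Y f] prec_graphs_iff[OF X Y g] close_maps_sym[OF Y]
    graph_mem_CtrTotRel[OF X f] graph_mem_CtrTotRel[OF X g] f g
  unfolding closeness_CtrTotRel_def closeness_CtrMap_def close_relations_def by blast

text \<open>Each property is pulled back from closeness of relations along the passage to graphs.\<close>

lemma equiv_closeness_CtrMap:
  assumes X: "coarse_structure (points X) (entourages X)"
    and Y: "coarse_structure (points Y) (entourages Y)"
  shows "equiv (CtrMap X Y) (closeness_CtrMap X Y)"
proof -
  note iff = close_graphs_iff[OF X Y] and G = graph_mem_CtrTotRel[OF X]
  have sub: "closeness_CtrMap X Y \<subseteq> CtrMap X Y \<times> CtrMap X Y"
    unfolding closeness_CtrMap_def by blast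
  have eq: "refl_on (CtrTotRel X Y) (closeness_CtrTotRel X Y)"
      "sym (closeness_CtrTotRel X Y)" "trans (closeness_CtrTotRel X Y)"
    using equiv_closeness_CtrTotRel[OF X Y] by (auto elim: equivE)
  show ?thesis
  proof (rule equivI[OF sub])
    show "refl_on (CtrMap X Y) (closeness_CtrMap X Y)"
      using refl_onD[OF eq(1) G] iff by (intro refl_onI) blast
    show "sym (closeness_CtrMap X Y)"
    proof (rule symI)
      fix f g assume fg: "(f, g) \<in> closeness_CtrMap X Y"
      then have mem: "f \<in> CtrMap X Y" "g \<in> CtrMap X Y" using sub by blast+
      show "(g, f) \<in> closeness_CtrMap X Y"
        using symD[OF eq(2) iff[OF mem, THEN iffD2, OF fg]] iff[OF mem(2,1)] by blast
    qed
    show "trans (closeness_CtrMap X Y)"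
    proof (rule transI)
      fix f g h
      assume fg: "(f, g) \<in> closeness_CtrMap X Y" and gh: "(g, h) \<in> closeness_CtrMap X Y"
      then have mem: "f \<in> CtrMap X Y" "g \<in> CtrMap X Y" "h \<in> CtrMap X Y" using sub by blast+
      show "(f, h) \<in> closeness_CtrMap X Y"
        using transD[OF eq(3) iff[OF mem(1,2), THEN iffD2, OF fg]
            iff[OF mem(2,3), THEN iffD2, OF gh]] iff[OF mem(1,3)] by blast
    qed
  qed
qed

lemma graph_compose: "f \<in> X \<rightarrow> Y \<Longrightarrow> graph X (compose X g f) = graph Y g O graph X f"
  unfolding graph_def by (auto simp: compose_def relcomp_unfold)

text \<open>
  The witness picks one value of \<open>\<eta>\<close> at each point.  Its graph lies in \<open>\<eta>\<close>, hence is
  controlled; conversely each \<open>(y, x) \<in> \<eta>\<close> is reached from \<open>(f x, x)\<close> along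
  \<open>(y, f x) \<in> Ad \<eta> Id\<close>.
\<close>

lemma ex_close_graph:
  assumes X: "coarse_structure (points X) (entourages X)"
    and Y: "coarse_structure (points Y) (entourages Y)"
    and \<eta>: "\<eta> \<in> CtrTotRel X Y"
  shows "\<exists>f\<in>CtrMap X Y. (graph (points X) f, \<eta>) \<in> closeness_CtrTotRel X Y"
proof -
  define f where "f = (\<lambda>x\<in>points X. SOME y. (y, x) \<in> \<eta>)"
  have f_val: "(f x, x) \<in> \<eta>" if "x \<in> points X" for x
    using someI_ex[OF CtrTotRelD(3)[OF \<eta> that]] that by (simp add: f_def)
  then have sub: "graph (points X) f \<subseteq> \<eta>" unfolding graph_def by blast
  have f_ext: "f \<in> points X \<rightarrow>\<^sub>E points Y"
    using f_val CtrTotRelD(1)[OF \<eta>] by (auto simp: f_def)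
  have "{(f x, f x') | x x'. (x, x') \<in> E} \<in> entourages Y" if E: "E \<in> entourages X" for E
  proof (rule coarse_structureD(5)[OF Y CtrTotRelD(2)[OF \<eta> E]])
    show "{(f x, f x') | x x'. (x, x') \<in> E} \<subseteq> Ad \<eta> E"
      using f_val coarse_structureD(1)[OF X E] unfolding Ad_def by blast
  qed
  then have f: "f \<in> CtrMap X Y" using f_ext unfolding CtrMap_def by blast
  have "\<eta> \<subseteq> Ad \<eta> (Id_on (points X)) O graph (points X) f"
    using f_val CtrTotRelD(1)[OF \<eta>] unfolding Ad_def graph_def by fast
  moreover have "Ad \<eta> (Id_on (points X)) \<in> entourages Y"
    using CtrTotRelD(2)[OF \<eta> coarse_structureD(2)[OF X]] .
  ultimately have "prec_relations X Y \<eta> (graph (points X) f)"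
    using prec_relations_iff[OF X Y graph_mem_CtrTotRel[OF X f]] by blast
  then show ?thesis
    using prec_relations_if_subset[OF X Y \<eta> sub] f \<eta> graph_mem_CtrTotRel[OF X f]
    unfolding closeness_CtrTotRel_def close_relations_def by blast
qed

text \<open>
  Taking graphs preserves composites, and two maps are close iff their graphs are; so the
  congruence on relations pulls back to maps.
\<close>

lemma compose_closeness_CtrMap:
  assumes X: "coarse_structure (points X) (entourages X)"
    and Y: "coarse_structure (points Y) (entourages Y)"
    and Z: "coarse_structure (points Z) (entourages Z)"
    and gg: "(g, g') \<in> closeness_CtrMap Y Z" and ff: "(f, f') \<in> closeness_CtrMap X Y"
  shows "(compose (points X) g f, compose (points X) g' f') \<in> closeness_CtrMap X Z"
proof -
  have mem: "g \<in> CtrMap Y Z" "g' \<in> CtrMap Y Z" "f \<in> CtrMap X Y" "f' \<in> CtrMap X Y"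
    using gg ff unfolding closeness_CtrMap_def by blast+
  note gg' = close_graphs_iff[OF Y Z mem(1,2), THEN iffD2, OF gg]
    and ff' = close_graphs_iff[OF X Y mem(3,4), THEN iffD2, OF ff]
  have "(graph (points X) (compose (points X) g f), graph (points X) (compose (points X) g' f'))
      \<in> closeness_CtrTotRel X Z"
    unfolding graph_compose[OF CtrMap_funcset[OF mem(3)]]
      graph_compose[OF CtrMap_funcset[OF mem(4)]]
    by (rule relcomp_closeness_CtrTotRel[OF X Y Z gg' ff'])
  then show ?thesis
    using close_graphs_iff[OF X Z compose_mem_CtrMap[OF X mem(1,3)]
        compose_mem_CtrMap[OF X mem(2,4)]] by blast
qed

section \<open>The graph functor\<close>

lemma coarse_spacesD: "X \<in> coarse_spaces \<U> \<Longrightarrow> coarse_structure (points X) (entourages X)"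
  unfolding coarse_spaces_def by blast

lemma is_category_Coarse_CtrMap: "is_category (Coarse_CtrMap \<U>)"
proof -
  have "compose (points X) (\<lambda>y\<in>points Y. y) f = f" and "compose (points X) f (\<lambda>x\<in>points X. x) = f"
    if "f \<in> CtrMap X Y" for X Y :: "'a coarse_space" and f
    using CtrMapD(1)[OF that] by (auto simp: PiE_def intro: Id_compose compose_Id)
  moreover have "compose (points W) h (compose (points W) g f) =
      compose (points W) (compose (points X) h g) f" if "f \<in> CtrMap W X"
    for W X :: "'a coarse_space" and f and g h :: "'a \<Rightarrow> 'a"
    using CtrMap_mem[OF that] by (simp add: compose_def cong: restrict_cong)
  ultimately show ?thesis
    unfolding is_category_def Coarse_CtrMap_def
    by (simp add: id_mem_CtrMap compose_mem_CtrMap coarse_spacesD)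
qed

lemma is_category_Coarse_CtrTotRel: "is_category (Coarse_CtrTotRel \<U>)"
proof -
  have Id: "Id_on (points Y) O \<eta> = \<eta>" "\<eta> O Id_on (points X) = \<eta>" if "\<eta> \<in> CtrTotRel X Y"
    for X Y :: "'a coarse_space" and \<eta>
    using CtrTotRelD(1)[OF that] by blast+
  show ?thesis
    unfolding is_category_def Coarse_CtrTotRel_def cat.simps O_assoc
    by (intro conjI ballI refl)
      (assumption | erule Id relcomp_mem_CtrTotRel | rule Id_on_mem_CtrTotRel coarse_spacesD)+
qed

definition graph_functor :: "('a coarse_space, 'a \<Rightarrow> 'a, 'a coarse_space, 'a rel) ftor" where
  "graph_functor = \<lparr> fobj = (\<lambda>X. X), fhom = (\<lambda>X Y. graph (points X)) \<rparr>"

lemma is_functor_graph_functor: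
  "is_functor (Coarse_CtrMap \<U>) (Coarse_CtrTotRel \<U>) graph_functor"
proof -
  have "graph A (\<lambda>x\<in>A. x) = Id_on A" for A :: "'a set"
    unfolding graph_def by auto
  moreover have "graph (points X) (compose (points X) g f) =
      graph (points Y) g O graph (points X) f" if "f \<in> CtrMap X Y"
    for X Y :: "'a coarse_space" and f and g :: "'a \<Rightarrow> 'a"
    by (rule graph_compose[OF CtrMap_funcset[OF that]])
  ultimately show ?thesis
    unfolding is_functor_def
    using is_category_Coarse_CtrMap[of \<U>] is_category_Coarse_CtrTotRel[of \<U>]
    by (simp add: Coarse_CtrMap_def Coarse_CtrTotRel_def graph_functor_def
        graph_mem_CtrTotRel coarse_spacesD)
qed

lemma category_congruence_closeness_CtrTotRel:
  "category_congruence (Coarse_CtrTotRel \<U>) closeness_CtrTotRel"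
  unfolding category_congruence_def Coarse_CtrTotRel_def cat.simps
  by (intro conjI ballI; clarify?)
    (blast dest: coarse_spacesD intro: equiv_closeness_CtrTotRel relcomp_closeness_CtrTotRel)+

lemma category_congruence_closeness_CtrMap:
  "category_congruence (Coarse_CtrMap \<U>) closeness_CtrMap"
  unfolding category_congruence_def Coarse_CtrMap_def cat.simps
  by (intro conjI ballI; clarify?)
    (blast dest: coarse_spacesD intro: equiv_closeness_CtrMap compose_closeness_CtrMap)+

theorem theorem4p19:
  fixes \<U> :: "'a set set"
  shows "\<exists>\<Phi>. is_category_isomorphism (Coarse_CtrMap_close \<U>) (Coarse_CtrTotRel_close \<U>) \<Phi> \<and>
     (\<forall>X\<in>coarse_spaces \<U>. fobj \<Phi> X = X) \<and>
     (\<forall>X\<in>coarse_spaces \<U>. \<forall>Y\<in>coarse_spaces \<U>. \<forall>f\<in>CtrMap X Y.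
        fhom \<Phi> X Y (class_CtrMap X Y f) = class_CtrTotRel X Y (graph (points X) f))"
proof (intro exI conjI ballI)
  let ?\<Phi> = "quotient_functor closeness_CtrTotRel graph_functor"
  have iff: "(graph (points X) f, graph (points X) g) \<in> closeness_CtrTotRel X Y \<longleftrightarrow>
      (f, g) \<in> closeness_CtrMap X Y"
    if "X \<in> coarse_spaces \<U>" "Y \<in> coarse_spaces \<U>" "f \<in> CtrMap X Y" "g \<in> CtrMap X Y"
    for X Y f g
    using close_graphs_iff that coarse_spacesD by blast
  show "is_category_isomorphism (Coarse_CtrMap_close \<U>) (Coarse_CtrTotRel_close \<U>) ?\<Phi>"
    unfolding Coarse_CtrMap_close_def Coarse_CtrTotRel_close_def
    by (rule category_isomorphism_quotient_functor[OF is_functor_graph_functor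
          category_congruence_closeness_CtrMap category_congruence_closeness_CtrTotRel])
      (simp_all add: Coarse_CtrMap_def Coarse_CtrTotRel_def graph_functor_def iff
        ex_close_graph coarse_spacesD bij_betw_def)
  fix X assume X: "X \<in> coarse_spaces \<U>"
  show "fobj ?\<Phi> X = X" by (simp add: graph_functor_def)
  fix Y f assume Y: "Y \<in> coarse_spaces \<U>" and f: "f \<in> CtrMap X Y"
  have "(graph (points X) f, graph (points X) f') \<in> closeness_CtrTotRel X Y"
    if "(f, f') \<in> closeness_CtrMap X Y" for f f'
    using iff[OF X Y] that unfolding closeness_CtrMap_def by blast
  then show "fhom ?\<Phi> X Y (class_CtrMap X Y f) = class_CtrTotRel X Y (graph (points X) f)"
    unfolding class_CtrMap_def class_CtrTotRel_def
    using fhom_quotient_functor[OF is_functor_graph_functor[of \<U>]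
        category_congruence_closeness_CtrMap category_congruence_closeness_CtrTotRel, of X Y f]
      X Y f by (simp add: Coarse_CtrMap_def graph_functor_def)
qed

end
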